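(* Let $\beta>0$ and let $f=h+\bar g$ be a sense-preserving harmonic mapping in $\mathbb{D}$, with $h,g$ analytic in $\mathbb{D}$, $h(0)=g(0)=0$, $h'(0)=1$, whose analytic part satisfies $h\in\mathcal{G}(\beta)$. Then $$\|P_f\|\le2\beta+1.$$ The estimate is best possible: for each $\beta>0$, the constant $2\beta+1$ cannot be replaced by a smaller one valid for all such $f$.
   Context: $\mathbb{D}=\{z\in\mathbb{C}:|z|<1\}$. $\mathcal{A}$ is the class of analytic functions $h$ on $\mathbb{D}$ with $h(0)=0$ and $h'(0)=1$. For $\beta>0$, $$\mathcal{G}(\beta)=\left\{h\in\mathcal{A}:\ \mathrm{Re}\left(1+\frac{zh''(z)}{h'(z)}\right)<1+\frac{\beta}{2}\ \text{ for } z\in\mathbb{D}\right\}.$$ A harmonic mapping $f=h+\bar g$ is sense-preserving if its Jacobian $J_f=|h'|^2-|g'|^2$ is positive on $\mathbb{D}$; its (second complex) dilatation is $\omega=g'/h'$, an analytic function with $|\omega|<1$. The pre-Schwarzian derivative of such $f$ is $$P_f(z)=(\log J_f)_z=\frac{h''(z)}{h'(z)}-\frac{\overline{\omega(z)}\,\omega'(z)}{1-|\omega(z)|^2},$$ and $\|P_f\|=\sup_{z\in\mathbb{D}}(1-|z|^2)|P_f(z)|$. *)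

theory Defs
  imports "HOL-Complex_Analysis.Complex_Analysis"
begin

abbreviation unit_disc :: "complex set" where
  "unit_disc \<equiv> ball 0 1"

definition class_A :: "(complex \<Rightarrow> complex) set" where
  "class_A = {h. h holomorphic_on unit_disc \<and> h 0 = 0 \<and> deriv h 0 = 1}"

text \<open>A zero of \<open>h'\<close> is a pole of \<open>z h'' / h'\<close>, so the inequality defining the class tacitly
  requires \<open>h' \<noteq> 0\<close> (at the origin this is the normalization). As \<open>x / 0 = 0\<close> in HOL, the
  requirement has to be made explicit.\<close>

definition class_G :: "real \<Rightarrow> (complex \<Rightarrow> complex) set" where
  "class_G \<beta> = {h \<in> class_A. \<forall>z\<in>unit_disc. deriv h z \<noteq> 0 \<and>
     Re (1 + z * deriv (deriv h) z / deriv h z) < 1 + \<beta> / 2}"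

text \<open>A harmonic mapping \<open>f = h + cnj g\<close> on the disc, with \<open>h\<close> and \<open>g\<close> analytic and \<open>g 0 = 0\<close>,
  is represented by the pair \<open>h\<close>, \<open>g\<close>, which \<open>f\<close> determines on the disc.\<close>

definition jacobian :: "(complex \<Rightarrow> complex) \<Rightarrow> (complex \<Rightarrow> complex) \<Rightarrow> complex \<Rightarrow> real" where
  "jacobian h g z = (norm (deriv h z))\<^sup>2 - (norm (deriv g z))\<^sup>2"

definition sense_preserving :: "(complex \<Rightarrow> complex) \<Rightarrow> (complex \<Rightarrow> complex) \<Rightarrow> bool" where
  "sense_preserving h g \<longleftrightarrow> (\<forall>z\<in>unit_disc. 0 < jacobian h g z)"

definition dilatation :: "(complex \<Rightarrow> complex) \<Rightarrow> (complex \<Rightarrow> complex) \<Rightarrow> complex \<Rightarrow> complex" where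
  "dilatation h g z = deriv g z / deriv h z"

text \<open>The Wirtinger derivative \<open>F\<^sub>z = (F\<^sub>x - \<i> F\<^sub>y) / 2\<close> of a real-differentiable function.\<close>

definition wirtinger_dz :: "(complex \<Rightarrow> complex) \<Rightarrow> complex \<Rightarrow> complex" where
  "wirtinger_dz F z =
     (frechet_derivative F (at z) 1 - \<i> * frechet_derivative F (at z) \<i>) / 2"

text \<open>\<open>P\<^sub>f = (log J\<^sub>f)\<^sub>z\<close>; the expression through the dilatation is the lemma
  \<open>pre_schwarzian_eq\<close> below.\<close>

definition pre_schwarzian :: "(complex \<Rightarrow> complex) \<Rightarrow> (complex \<Rightarrow> complex) \<Rightarrow> complex \<Rightarrow> complex" where
  "pre_schwarzian h g = wirtinger_dz (\<lambda>w. complex_of_real (ln (jacobian h g w)))"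

text \<open>The supremum is taken in the extended reals, so that it is meaningful (and the
  bound is not vacuous) without assuming boundedness.\<close>

definition pre_schwarzian_norm :: "(complex \<Rightarrow> complex) \<Rightarrow> (complex \<Rightarrow> complex) \<Rightarrow> ereal" where
  "pre_schwarzian_norm h g =
     (SUP z\<in>unit_disc. ereal ((1 - (norm z)\<^sup>2) * norm (pre_schwarzian h g z)))"

definition harmonic_G :: "real \<Rightarrow> (complex \<Rightarrow> complex) \<Rightarrow> (complex \<Rightarrow> complex) \<Rightarrow> bool" where
  "harmonic_G \<beta> h g \<longleftrightarrow> h \<in> class_G \<beta> \<and> g holomorphic_on unit_disc \<and> g 0 = 0 \<and>
     sense_preserving h g"

lemma pre_schwarzian_eq:
  assumes h: "h holomorphic_on unit_disc" and g: "g holomorphic_on unit_disc"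
    and sp: "sense_preserving h g" and z: "z \<in> unit_disc"
  shows "pre_schwarzian h g z =
    deriv (deriv h) z / deriv h z -
    cnj (dilatation h g z) * deriv (dilatation h g) z /
      complex_of_real (1 - (norm (dilatation h g z))\<^sup>2)"
proof -
  define a b a' b' where ab: "a = deriv h z" "b = deriv g z"
    "a' = deriv (deriv h) z" "b' = deriv (deriv g) z"
  define J where "J = jacobian h g z"
  have Jpos: "J > 0" using sp z by (simp add: sense_preserving_def J_def)
  have J: "complex_of_real J = a * cnj a - b * cnj b"
    unfolding J_def jacobian_def ab of_real_diff complex_norm_square by (rule refl)
  have a0: "a \<noteq> 0"
    using Jpos by (auto simp: J_def jacobian_def ab)
  have dh: "(deriv h has_field_derivative a') (at z)"
    unfolding ab by (rule holomorphic_derivI[OF holomorphic_deriv[OF h open_ball] open_ball z])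
  have dg: "(deriv g has_field_derivative b') (at z)"
    unfolding ab by (rule holomorphic_derivI[OF holomorphic_deriv[OF g open_ball] open_ball z])
  have dh': "(deriv h has_derivative (\<lambda>v. a' * v)) (at z)"
    and dg': "(deriv g has_derivative (\<lambda>v. b' * v)) (at z)"
    using dh dg by (simp_all add: has_field_derivative_def)
  have "((\<lambda>w. jacobian h g w) has_derivative
      (\<lambda>v. 2 * (a \<bullet> (a' * v)) - 2 * (b \<bullet> (b' * v)))) (at z)"
    unfolding jacobian_def power2_norm_eq_inner
    by (rule derivative_eq_intros dh' dg' refl)+ (auto simp: ab inner_commute)
  then have "((\<lambda>w. ln (jacobian h g w)) has_derivative
      (\<lambda>v. (2 * (a \<bullet> (a' * v)) - 2 * (b \<bullet> (b' * v))) * inverse J)) (at z)"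
    using Jpos by (auto simp: J_def intro!: has_derivative_ln)
  then have "((\<lambda>w. complex_of_real (ln (jacobian h g w))) has_derivative
      (\<lambda>v. complex_of_real ((2 * (a \<bullet> (a' * v)) - 2 * (b \<bullet> (b' * v))) * inverse J))) (at z)"
    by (rule has_derivative_of_real)
  then have "frechet_derivative (\<lambda>w. complex_of_real (ln (jacobian h g w))) (at z) =
      (\<lambda>v. complex_of_real ((2 * (a \<bullet> (a' * v)) - 2 * (b \<bullet> (b' * v))) * inverse J))"
    by (rule frechet_derivative_at[symmetric])
  then have "pre_schwarzian h g z = (a' * cnj a - b' * cnj b) / complex_of_real J"
    using Jpos unfolding pre_schwarzian_def wirtinger_dz_def
    by (simp add: complex_eq_iff inner_complex_def field_simps Re_divide_of_real Im_divide_of_real)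
  moreover have "deriv (dilatation h g) z = (b' * a - b * a') / (a * a)"
  proof -
    have "((\<lambda>w. deriv g w / deriv h w) has_field_derivative (b' * a - b * a') / (a * a)) (at z)"
      using DERIV_divide[OF dg dh] a0 unfolding ab by simp
    then show ?thesis
      unfolding dilatation_def[abs_def] by (rule DERIV_imp_deriv)
  qed
  moreover have "complex_of_real (1 - (norm (dilatation h g z))\<^sup>2) = complex_of_real J / (a * cnj a)"
  proof -
    have "complex_of_real (1 - (norm (dilatation h g z))\<^sup>2) = 1 - (b / a) * cnj (b / a)"
      unfolding dilatation_def ab[symmetric] of_real_diff complex_norm_square by simp
    also have "\<dots> = complex_of_real J / (a * cnj a)"
      unfolding J using a0 by (simp add: field_simps)
    finally show ?thesis .
  qed
  moreover have "(a' * cnj a - b' * cnj b) / complex_of_real J =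
      a' / a - cnj (b / a) * ((b' * a - b * a') / (a * a)) / (complex_of_real J / (a * cnj a))"
  proof -
    have nz: "complex_of_real J \<noteq> 0" "cnj a \<noteq> 0" using Jpos a0 by auto
    have "a' / a - cnj (b / a) * ((b' * a - b * a') / (a * a)) / (complex_of_real J / (a * cnj a))
        = (a' * complex_of_real J - cnj b * (b' * a - b * a')) / (a * complex_of_real J)"
      using nz a0 by (simp add: field_simps)
    also have "\<dots> = (a * (a' * cnj a - b' * cnj b)) / (a * complex_of_real J)"
      unfolding J by (simp add: algebra_simps)
    also have "\<dots> = (a' * cnj a - b' * cnj b) / complex_of_real J"
      using a0 by simp
    finally show ?thesis by simp
  qed
  ultimately show ?thesis
    by (simp add: dilatation_def ab)
qed

end

theory Submission
  imports Defs
begin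

text \<open>For \<open>h \<in> \<G>(\<beta>)\<close> put \<open>q = h'' / h'\<close>. The condition \<open>Re (z q) < \<beta> / 2\<close> says that
  \<open>\<phi> = z q / (z q - \<beta>)\<close> is a Schwarz function, and solving for \<open>z q\<close> gives
  \<open>|q| \<le> \<beta> / (1 - |z|)\<close>, so the analytic part of the pre-Schwarzian contributes at most
  \<open>\<beta> (1 + |z|) \<le> 2 \<beta>\<close>. The dilatation part contributes at most \<open>1\<close> by the Schwarz--Pick lemma.
  Both bounds are approached simultaneously along the positive radius by \<open>h' = (1 - z)\<^sup>\<beta>\<close>
  and \<open>\<omega>(z) = z\<close>.\<close>

section \<open>Moebius maps and the Schwarz--Pick lemma\<close>

lemma Moebius_function_has_field_derivative:
  assumes "1 - cnj w * z \<noteq> 0"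
  shows "(Moebius_function 0 w has_field_derivative
           complex_of_real (1 - (norm w)\<^sup>2) / (1 - cnj w * z)\<^sup>2) (at z)"
  unfolding Moebius_function_simple[abs_def] of_real_diff complex_norm_square
  by (rule derivative_eq_intros refl assms)+
     (use assms in \<open>simp add: field_simps power2_eq_square\<close>)

lemma Schwarz_Pick:
  assumes hol: "\<omega> holomorphic_on ball 0 1"
    and bound: "\<And>z. norm z < 1 \<Longrightarrow> norm (\<omega> z) < 1" and z: "norm z < 1"
  shows "(1 - (norm z)\<^sup>2) * norm (deriv \<omega> z) \<le> 1 - (norm (\<omega> z))\<^sup>2"
proof -
  define a where "a = \<omega> z"
  have a: "norm a < 1" using bound z by (simp add: a_def)
  then have a2: "(norm a)\<^sup>2 < 1" by (simp add: abs_square_less_1)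
  have z2: "(norm z)\<^sup>2 < 1" using z by (simp add: abs_square_less_1)
  \<comment> \<open>The inner automorphism sends \<open>0\<close> to \<open>z\<close> and the outer
    one sends \<open>\<omega> z\<close> to \<open>0\<close>, so \<open>F\<close> fixes the origin
    and the Schwarz lemma bounds \<open>deriv F 0\<close>; the chain rule turns this into the
    claim.\<close>
  define F where "F = Moebius_function 0 a \<circ> \<omega> \<circ> Moebius_function 0 (- z)"
  have m: "norm (Moebius_function 0 (- z) u) < 1" if "norm u < 1" for u
    using Moebius_function_norm_lt_1[of "- z" u 0] z that by simp
  have m0: "Moebius_function 0 (- z) 0 = z" by (simp add: Moebius_function_simple)
  have "F holomorphic_on ball 0 1"
    unfolding F_def
  proof (intro holomorphic_on_compose_gen)
    show "Moebius_function 0 (- z) holomorphic_on ball 0 1" "Moebius_function 0 a holomorphic_on ball 0 1"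
      using z a by (auto intro: Moebius_function_holomorphic)
  qed (use hol m bound in auto)
  moreover have "F 0 = 0" by (simp add: F_def m0 a_def Moebius_function_eq_zero)
  moreover have "norm (F u) < 1" if "norm u < 1" for u
    unfolding F_def using that a bound m by (simp add: Moebius_function_norm_lt_1)
  ultimately have le1: "norm (deriv F 0) \<le> 1"
    using Schwarz_Lemma(2)[of F 0] by simp
  have nz: "1 - cnj a * a = complex_of_real (1 - (norm a)\<^sup>2)"
    unfolding of_real_diff complex_norm_square by (simp add: mult.commute)
  have "(\<omega> has_field_derivative deriv \<omega> z) (at z)"
    using holomorphic_derivI[OF hol open_ball] z by simp
  moreover have "(Moebius_function 0 (- z) has_field_derivative complex_of_real (1 - (norm z)\<^sup>2)) (at 0)"
    using Moebius_function_has_field_derivative[of "- z" 0] by simp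
  \<comment> \<open>At the zero \<open>a\<close> of the automorphism the denominator is the square
    of the numerator, which leaves the reciprocal.\<close>
  moreover have "(Moebius_function 0 a has_field_derivative inverse (complex_of_real (1 - (norm a)\<^sup>2))) (at a)"
  proof -
    have "complex_of_real (1 - (norm a)\<^sup>2) \<noteq> 0" using a2 by (metis of_real_eq_0_iff less_irrefl diff_gt_0_iff_gt)
    then show ?thesis
      using Moebius_function_has_field_derivative[of a a] unfolding nz power2_eq_square[of "complex_of_real _"]
      by (simp only: nonzero_divide_mult_cancel_left inverse_eq_divide not_False_eq_True)
  qed
  ultimately have "(F has_field_derivative
      inverse (complex_of_real (1 - (norm a)\<^sup>2)) * (deriv \<omega> z * complex_of_real (1 - (norm z)\<^sup>2))) (at 0)"
    unfolding F_def comp_assoc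
    by (intro DERIV_chain) (simp_all add: m0 a_def)
  then have "norm (inverse (complex_of_real (1 - (norm a)\<^sup>2)) *
      (deriv \<omega> z * complex_of_real (1 - (norm z)\<^sup>2))) \<le> 1"
    using le1 by (simp add: DERIV_imp_deriv)
  then have "norm (deriv \<omega> z) * (1 - (norm z)\<^sup>2) / (1 - (norm a)\<^sup>2) \<le> 1"
    using a2 z2 by (simp only: norm_mult norm_inverse norm_of_real) (simp add: field_simps)
  then show ?thesis
    using a2 by (simp add: a_def field_simps)
qed

section \<open>Growth of a function whose product with z stays in a half-plane\<close>

text \<open>The line \<open>Re p = \<beta> / 2\<close> is the perpendicular bisector of
  \<open>0\<close> and \<open>\<beta>\<close>; the squared distances differ by
  \<open>\<beta> * (\<beta> - 2 * Re p)\<close>. Hence \<open>p / (p - \<beta>)\<close> has modulus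
  below 1.\<close>

lemma norm_less_norm_diff_of_real:
  fixes p :: complex
  assumes "\<beta> > 0" "Re p < \<beta> / 2"
  shows "norm p < norm (p - of_real \<beta>)"
proof -
  have "0 < \<beta> * (\<beta> - 2 * Re p)" using assms by simp
  then have "(norm p)\<^sup>2 < (norm (p - of_real \<beta>))\<^sup>2"
    unfolding cmod_power2 by (simp add: power2_eq_square algebra_simps)
  then show ?thesis by (rule power_less_imp_less_base) simp
qed

lemma half_plane_bound:
  assumes \<beta>: "\<beta> > 0" and hol: "q holomorphic_on ball 0 1"
    and re: "\<And>z. norm z < 1 \<Longrightarrow> Re (z * q z) < \<beta> / 2" and z: "norm z < 1"
  shows "(1 - norm z) * norm (q z) \<le> \<beta>"
proof -
  define \<phi> where "\<phi> = (\<lambda>z. z * q z / (z * q z - of_real \<beta>))"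
  note less = norm_less_norm_diff_of_real[OF \<beta> re]
  have nz: "u * q u - of_real \<beta> \<noteq> 0" if "norm u < 1" for u
    using less[OF that] by auto
  have hol\<phi>: "\<phi> holomorphic_on ball 0 1"
    unfolding \<phi>_def by (intro holomorphic_intros hol) (use nz in auto)
  have \<phi>0: "\<phi> 0 = 0" by (simp add: \<phi>_def)
  have \<phi>1: "norm (\<phi> u) < 1" if "norm u < 1" for u
    using less[OF that] nz[OF that] by (simp add: \<phi>_def norm_divide)
  show ?thesis
  proof (cases "z = 0")
    \<comment> \<open>At the origin the factor \<open>z\<close> cannot be cancelled; the derivative
      part of the Schwarz lemma gives the bound instead.\<close>
    case True
    have "(q has_field_derivative deriv q 0) (at 0)"
      using holomorphic_derivI[OF hol open_ball] by simp
    then have "(\<phi> has_field_derivative - q 0 / of_real \<beta>) (at 0)"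
      unfolding \<phi>_def using \<beta>
      by (auto intro!: derivative_eq_intros simp: field_simps)
    then have "deriv \<phi> 0 = - q 0 / of_real \<beta>" by (rule DERIV_imp_deriv)
    then show ?thesis
      using Schwarz_Lemma(2)[OF hol\<phi> \<phi>0 \<phi>1 z] True \<beta> by (simp add: norm_divide)
  next
    case False
    have "norm (\<phi> z) \<le> norm z" using Schwarz_Lemma(1)[OF hol\<phi> \<phi>0 \<phi>1 z] .
    \<comment> \<open>Cancelling \<open>norm z\<close> leaves \<open>norm (q z)\<close> bounded by
      \<open>norm z * norm (q z) + \<beta>\<close>, which is then solved for
      \<open>norm (q z)\<close>.\<close>
    then have "norm z * norm (q z) \<le> norm z * norm (z * q z - of_real \<beta>)"
      using nz[OF z] by (simp add: \<phi>_def norm_divide norm_mult field_simps)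
    then have "norm (q z) \<le> norm (z * q z - of_real \<beta>)" using False by simp
    also have "\<dots> \<le> norm z * norm (q z) + \<beta>"
      using norm_triangle_ineq4[of "z * q z" "of_real \<beta>"] \<beta> by (simp add: norm_mult)
    finally show ?thesis by (simp add: algebra_simps)
  qed
qed

section \<open>The upper bound\<close>

lemma pre_schwarzian_norm_le:
  assumes \<beta>: "\<beta> > 0" and "harmonic_G \<beta> h g"
  shows "pre_schwarzian_norm h g \<le> ereal (2 * \<beta> + 1)"
  unfolding pre_schwarzian_norm_def
proof (rule SUP_least)
  fix z :: complex assume zb: "z \<in> ball 0 1"
  then have z: "norm z < 1" by simp
  have h: "h holomorphic_on ball 0 1" and g: "g holomorphic_on ball 0 1"
    and sp: "sense_preserving h g"
    and nz: "\<And>u. u \<in> ball 0 1 \<Longrightarrow> deriv h u \<noteq> 0"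
    and re: "\<And>u. norm u < 1 \<Longrightarrow> Re (u * (deriv (deriv h) u / deriv h u)) < \<beta> / 2"
    using assms(2) by (auto simp: harmonic_G_def class_G_def class_A_def)
  define q where "q = (\<lambda>z. deriv (deriv h) z / deriv h z)"
  define \<omega> where "\<omega> = dilatation h g"
  have "q holomorphic_on ball 0 1"
    unfolding q_def using h nz by (intro holomorphic_intros) auto
  then have "(1 - norm z) * norm (q z) \<le> \<beta>"
    using half_plane_bound[OF \<beta> _ _ z] re unfolding q_def by blast
  \<comment> \<open>The factor \<open>1 + norm z\<close> completes \<open>1 - norm z\<close> to the
    weight in the norm and costs at most 2.\<close>
  then have "(1 + norm z) * ((1 - norm z) * norm (q z)) \<le> (1 + norm z) * \<beta>"
    by (intro mult_left_mono) auto
  also have "\<dots> \<le> 2 * \<beta>" using z \<beta> by simp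
  finally have 1: "(1 - (norm z)\<^sup>2) * norm (q z) \<le> 2 * \<beta>"
    by (simp add: power2_eq_square algebra_simps)
  have hol\<omega>: "\<omega> holomorphic_on ball 0 1"
    unfolding \<omega>_def dilatation_def[abs_def] using h g nz by (intro holomorphic_intros) auto
  have \<omega>1: "norm (\<omega> u) < 1" if "norm u < 1" for u
  proof -
    have "(norm (deriv g u))\<^sup>2 < (norm (deriv h u))\<^sup>2"
      using sp that by (simp add: sense_preserving_def jacobian_def)
    then have "norm (deriv g u) < norm (deriv h u)"
      by (rule power_less_imp_less_base) simp
    then show ?thesis using nz[of u] that by (simp add: \<omega>_def dilatation_def norm_divide)
  qed
  define D where "D = 1 - (norm (\<omega> z))\<^sup>2"
  have D: "D > 0" using \<omega>1[OF z] by (simp add: D_def abs_square_less_1)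
  have z2: "1 - (norm z)\<^sup>2 \<ge> 0" using z by (simp add: abs_square_le_1)
  have "(1 - (norm z)\<^sup>2) * norm (deriv \<omega> z) \<le> D"
    unfolding D_def by (rule Schwarz_Pick[OF hol\<omega> \<omega>1 z])
  \<comment> \<open>Schwarz--Pick cancels the denominator \<open>D\<close>; the remaining factor
    \<open>norm (\<omega> z)\<close> is below 1.\<close>
  then have "norm (\<omega> z) * ((1 - (norm z)\<^sup>2) * norm (deriv \<omega> z)) \<le> 1 * D"
    using \<omega>1[OF z] z2 by (intro mult_mono) auto
  then have 2: "(1 - (norm z)\<^sup>2) * norm (cnj (\<omega> z) * deriv \<omega> z / complex_of_real D) \<le> 1"
    using D by (simp add: norm_divide norm_mult field_simps)
  have "norm (pre_schwarzian h g z) \<le> norm (q z) + norm (cnj (\<omega> z) * deriv \<omega> z / complex_of_real D)"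
    unfolding pre_schwarzian_eq[OF h g sp zb] q_def \<omega>_def D_def by (rule norm_triangle_ineq4)
  then have "(1 - (norm z)\<^sup>2) * norm (pre_schwarzian h g z)
      \<le> (1 - (norm z)\<^sup>2) * (norm (q z) + norm (cnj (\<omega> z) * deriv \<omega> z / complex_of_real D))"
    using z2 by (rule mult_left_mono)
  then show "ereal ((1 - (norm z)\<^sup>2) * norm (pre_schwarzian h g z)) \<le> ereal (2 * \<beta> + 1)"
    using 1 2 by (simp add: distrib_left)
qed

section \<open>Sharpness\<close>

text \<open>The extremal \<open>h\<close> and \<open>g\<close> are prescribed through their
  derivatives and recovered as normalized primitives.\<close>

lemma ball_primitive_exists:
  assumes "f holomorphic_on ball 0 1"
  obtains F where "F holomorphic_on ball 0 1" "F 0 = 0" "\<And>z. z \<in> ball 0 1 \<Longrightarrow> deriv F z = f z"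
proof -
  obtain G where G: "\<And>z. z \<in> ball 0 1 \<Longrightarrow> (G has_field_derivative f z) (at z within ball 0 1)"
    using holomorphic_convex_primitive'[OF convex_ball open_ball assms] by blast
  define F where "F = (\<lambda>z. G z - G 0)"
  have F: "(F has_field_derivative f z) (at z)" if "z \<in> ball 0 1" for z
    using G[OF that] that unfolding F_def
    by (auto simp: at_within_open[of _ "ball 0 1"] intro!: derivative_eq_intros)
  show ?thesis
  proof
    show "F holomorphic_on ball 0 1"
      unfolding holomorphic_on_open[OF open_ball] using F by blast
  qed (use F in \<open>auto simp: F_def intro: DERIV_imp_deriv\<close>)
qed

text \<open>Since \<open>Re z < 1\<close>, the point \<open>1 - z\<close> lies in the right
  half-plane; this keeps the principal power of \<open>1 - z\<close> away from its branch
  cut.\<close>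

lemma one_minus_notin_nonpos_Reals:
  fixes z :: complex
  assumes "norm z < 1"
  shows "1 - z \<notin> \<real>\<^sub>\<le>\<^sub>0"
  using complex_Re_le_cmod[of z] assms by (auto simp: complex_nonpos_Reals_iff)

text \<open>Up to the factor \<beta> this is \<open>z h'' / h'\<close> for the extremal
  \<open>h\<close>. It equals \<open>1 - 1 / (1 - z)\<close>, and
  \<open>Re (1 / (1 - z)) > 1 / 2\<close> is a rewriting of \<open>norm z < 1\<close>.\<close>

lemma Re_half_plane_map_less:
  fixes z :: complex
  assumes z: "norm z < 1"
  shows "Re (- z / (1 - z)) < 1 / 2"
proof -
  have nz: "1 - z \<noteq> 0" using z by auto
  have "- z / (1 - z) = 1 - 1 / (1 - z)" using nz by (simp add: field_simps)
  moreover have "Re (1 / (1 - z)) > 1 / 2"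
  proof -
    have "(norm z)\<^sup>2 < 1" using z by (simp add: abs_square_less_1)
    then have "(norm (1 - z))\<^sup>2 < 2 * Re (1 - z)"
      by (simp add: cmod_power2) (simp add: power2_eq_square algebra_simps)
    moreover have "Re (1 / (1 - z)) = Re (1 - z) / (norm (1 - z))\<^sup>2"
      by (simp add: Re_divide cmod_power2)
    moreover have "0 < (norm (1 - z))\<^sup>2" using nz by simp
    ultimately show ?thesis by (simp only: pos_less_divide_eq)
  qed
  ultimately show ?thesis by simp
qed

lemma harmonic_G_extremal:
  assumes \<beta>: "\<beta> > 0"
  obtains h g where "harmonic_G \<beta> h g"
    "\<And>x. 0 \<le> x \<Longrightarrow> x < 1 \<Longrightarrow>
       (1 - (norm (complex_of_real x))\<^sup>2) * norm (pre_schwarzian h g (of_real x)) = \<beta> * (1 + x) + x"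
proof -
  define k where "k = (\<lambda>z::complex. (1 - z) powr of_real \<beta>)"
  note cut = one_minus_notin_nonpos_Reals
  have k_nz: "k z \<noteq> 0" if "norm z < 1" for z
    using cut[OF that] by (auto simp: k_def)
  have dk: "(k has_field_derivative (- of_real \<beta> / (1 - z)) * k z) (at z)" if "norm z < 1" for z
  proof -
    have "1 - z \<noteq> 0" using that by auto
    then show ?thesis
      unfolding k_def using cut[OF that]
      by (auto intro!: derivative_eq_intros simp: powr_diff field_simps)
  qed
  have holk: "k holomorphic_on ball 0 1"
    unfolding holomorphic_on_open[OF open_ball] using dk by (metis mem_ball_0)
  obtain h where h: "h holomorphic_on ball 0 1" "h 0 = 0" "\<And>z. z \<in> ball 0 1 \<Longrightarrow> deriv h z = k z"
    using ball_primitive_exists[OF holk] by blast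
  \<comment> \<open>Taking \<open>g' = z h'\<close> makes the dilatation the identity, for which
    Schwarz--Pick is an equality at every point.\<close>
  have "(\<lambda>z. z * k z) holomorphic_on ball 0 1" by (intro holomorphic_intros holk)
  then obtain g where g: "g holomorphic_on ball 0 1" "g 0 = 0"
      "\<And>z. z \<in> ball 0 1 \<Longrightarrow> deriv g z = z * k z"
    using ball_primitive_exists by blast
  have ddh: "deriv (deriv h) z = (- of_real \<beta> / (1 - z)) * k z" if "norm z < 1" for z
  proof -
    \<comment> \<open>\<open>deriv h\<close> is known to agree with \<open>k\<close> only on the
      disc, so the derivative is transferred by equality on a neighbourhood of
      \<open>z\<close>.\<close>
    have "deriv (deriv h) z = deriv k z"
      using that h(3) by (intro deriv_cong_ev eventually_nhds_in_open[THEN eventually_mono, of "ball 0 1"]) auto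
    then show ?thesis using DERIV_imp_deriv[OF dk[OF that]] by simp
  qed
  have \<omega>: "dilatation h g z = z" if "norm z < 1" for z
    using that h(3) g(3) k_nz by (simp add: dilatation_def)
  have d\<omega>: "deriv (dilatation h g) z = 1" if "norm z < 1" for z
  proof -
    have "deriv (dilatation h g) z = deriv (\<lambda>z. z) z"
      using that \<omega> by (intro deriv_cong_ev eventually_nhds_in_open[THEN eventually_mono, of "ball 0 1"]) auto
    then show ?thesis by simp
  qed
  have sp: "sense_preserving h g"
    unfolding sense_preserving_def jacobian_def
  proof
    fix z :: complex assume "z \<in> ball 0 1"
    then have "(norm z)\<^sup>2 < 1" "0 < (norm (k z))\<^sup>2" "deriv h z = k z" "deriv g z = z * k z"
      using h(3) g(3) k_nz by (auto simp: abs_square_less_1)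
    then show "0 < (norm (deriv h z))\<^sup>2 - (norm (deriv g z))\<^sup>2"
      by (simp add: norm_mult power_mult_distrib)
  qed
  have "h \<in> class_G \<beta>"
    unfolding class_G_def class_A_def
  proof (intro CollectI conjI ballI)
    show "deriv h 0 = 1" using h(3) by (simp add: k_def)
    fix z :: complex assume "z \<in> ball 0 1"
    then have z: "norm z < 1" by simp
    show "deriv h z \<noteq> 0" using z h(3) k_nz by simp
    have "z * deriv (deriv h) z / deriv h z = of_real \<beta> * (- z / (1 - z))"
      using z h(3) k_nz ddh by simp
    moreover have "Re (of_real \<beta> * (- z / (1 - z))) < \<beta> * (1 / 2)"
      using mult_strict_left_mono[OF Re_half_plane_map_less[OF z] \<beta>]
      unfolding times_complex.sel by simp
    ultimately show "Re (1 + z * deriv (deriv h) z / deriv h z) < 1 + \<beta> / 2"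
      by simp
  qed (use h in auto)
  then have hG: "harmonic_G \<beta> h g" using g sp by (simp add: harmonic_G_def)
  moreover have "(1 - (norm (complex_of_real x))\<^sup>2) * norm (pre_schwarzian h g (of_real x))
      = \<beta> * (1 + x) + x" if x: "0 \<le> x" "x < 1" for x
  proof -
    have n: "norm (complex_of_real x) < 1" using x by simp
    have x2: "1 - x\<^sup>2 > 0" using x by (simp add: abs_square_less_1)
    \<comment> \<open>On the positive radius both terms of the pre-Schwarzian are real and
      nonpositive, so their moduli add without cancellation.\<close>
    have "pre_schwarzian h g (of_real x) = of_real (- (\<beta> / (1 - x) + x / (1 - x\<^sup>2)))"
      using pre_schwarzian_eq[OF h(1) g(1) sp, of "of_real x"] n h(3) k_nz
      by (simp add: ddh \<omega> d\<omega>)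
    moreover have "0 \<le> \<beta> / (1 - x) + x / (1 - x\<^sup>2)" using x x2 \<beta> by simp
    ultimately have "norm (pre_schwarzian h g (of_real x)) = \<beta> / (1 - x) + x / (1 - x\<^sup>2)"
      by (simp only: norm_of_real abs_minus_cancel abs_of_nonneg)
    then have "(1 - (norm (complex_of_real x))\<^sup>2) * norm (pre_schwarzian h g (of_real x))
        = (1 - x\<^sup>2) * (\<beta> / (1 - x)) + (1 - x\<^sup>2) * (x / (1 - x\<^sup>2))"
      by (simp add: distrib_left)
    also have "(1 - x\<^sup>2) * (\<beta> / (1 - x)) = \<beta> * (1 + x)"
      using x by (simp add: field_simps power2_eq_square)
    also have "(1 - x\<^sup>2) * (x / (1 - x\<^sup>2)) = x" using x2 by simp
    finally show ?thesis .
  qed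
  ultimately show ?thesis by (rule that)
qed

theorem theorem3p1:
  fixes \<beta> :: real
  assumes "\<beta> > 0"
  shows "(\<forall>h g. harmonic_G \<beta> h g \<longrightarrow> pre_schwarzian_norm h g \<le> ereal (2 * \<beta> + 1)) \<and>
    \<not> (\<exists>C::real. C < 2 * \<beta> + 1 \<and>
      (\<forall>h g. harmonic_G \<beta> h g \<longrightarrow> pre_schwarzian_norm h g \<le> ereal C))"
proof (intro conjI allI impI notI)
  show "pre_schwarzian_norm h g \<le> ereal (2 * \<beta> + 1)" if "harmonic_G \<beta> h g" for h g
    using pre_schwarzian_norm_le[OF assms that] .
next
  assume "\<exists>C::real. C < 2 * \<beta> + 1 \<and>
      (\<forall>h g. harmonic_G \<beta> h g \<longrightarrow> pre_schwarzian_norm h g \<le> ereal C)"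
  then obtain C :: real where C: "C < 2 * \<beta> + 1"
    "\<And>h g. harmonic_G \<beta> h g \<Longrightarrow> pre_schwarzian_norm h g \<le> ereal C" by blast
  obtain h g where hg: "harmonic_G \<beta> h g"
    "\<And>x. 0 \<le> x \<Longrightarrow> x < 1 \<Longrightarrow>
       (1 - (norm (complex_of_real x))\<^sup>2) * norm (pre_schwarzian h g (of_real x)) = \<beta> * (1 + x) + x"
    using harmonic_G_extremal[OF assms] by blast
  have le: "\<beta> * (1 + x) + x \<le> C" if x: "0 \<le> x" "x < 1" for x
  proof -
    have "ereal ((1 - (norm (complex_of_real x))\<^sup>2) * norm (pre_schwarzian h g (of_real x)))
        \<le> pre_schwarzian_norm h g"
      unfolding pre_schwarzian_norm_def using x by (intro SUP_upper) simp
    also have "\<dots> \<le> ereal C" using C(2) hg(1) .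
    finally show ?thesis using hg(2)[OF x] by simp
  qed
  \<comment> \<open>Each value with \<open>x < 1\<close> lies strictly below
    \<open>2 * \<beta> + 1\<close>, so the contradiction arises only in the limit at the boundary
    point 1.\<close>
  have "((\<lambda>x. \<beta> * (1 + x) + x) \<longlongrightarrow> \<beta> * (1 + 1) + 1) (at_left 1)"
    by (intro tendsto_intros)
  moreover have "\<forall>\<^sub>F x in at_left 1. \<beta> * (1 + x) + x \<le> C"
    using eventually_at_left_real[of 0 "1::real"] by (rule eventually_mono) (auto intro: le)
  ultimately have "\<beta> * (1 + 1) + 1 \<le> C"
    by (intro tendsto_upperbound) auto
  then show False using C(1) by simp
qed

end
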